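(* Let $m$ be a positive integer, $c$ be a positive real number, $\alpha\in\mathbb{C}$, and let $$f_k(z)=z+\overline{\alpha z^k\sum_{n=0}^m\binom{m}{n}\frac{(m-n+1,n)}{(c,n)}z^n}\quad\text{for } k=1,2.$$ (a) If $0<|\alpha|<1/2$ and $$\frac{\Gamma(c)\Gamma(c+2m-1)}{(\Gamma(c+m))^2}\,[m^2+2(c+2m-1)]\le\frac{1}{|\alpha|},$$ then $f_2\in\mathcal{S}_H^{*0}\cap\mathcal{C}_H^1$, and $f_2$ is indeed fully starlike in $\mathbb{D}$. (b) If $0<|\alpha|<1$ and $$\frac{\Gamma(c)\Gamma(c+2m-1)}{(\Gamma(c+m))^2}\,[m^2+c+2m-1]\le\frac{1}{|\alpha|},$$ then $f_1\in\mathcal{C}_H^1$.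
   Context: $\mathbb{D}=\{z\in\mathbb{C}:|z|<1\}$. $(x,0)=1$ and $(x,n)=x(x+1)\cdots(x+n-1)$ for positive integers $n$ (Pochhammer symbol). $\mathcal{H}$ is the class of complex-valued harmonic functions $f=h+\overline{g}$ in $\mathbb{D}$ with $h(z)=z+\sum_{n=2}^\infty a_nz^n$ and $g(z)=\sum_{n=1}^\infty b_nz^n$ analytic in $\mathbb{D}$. $\mathcal{S}_H$ is the class of $f\in\mathcal{H}$ that are univalent and sense-preserving (i.e. $|h'|^2-|g'|^2>0$) in $\mathbb{D}$. $\mathcal{C}_H^1=\{f\in\mathcal{S}_H:\ \mathrm{Re}\,f_z(z)>|f_{\overline z}(z)|\text{ for all } z\in\mathbb{D}\}$, where $f_z=h'$ and $f_{\overline z}=\overline{g'}$. $\mathcal{S}_H^{*0}$ is the class of $f\in\mathcal{S}_H$ with $f_{\overline z}(0)=0$ such that $f(\mathbb{D})$ is a starlike domain with respect to the origin. $f$ is fully starlike in $\mathbb{D}$ if for each $0<r<1$ the disk $|z|<r$ is mapped by $f$ onto a domain starlike with respect to the origin. *)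

theory Defs
  imports "HOL-Complex_Analysis.Complex_Analysis"
begin

abbreviation unit_disk :: "complex set" where
  "unit_disk \<equiv> ball 0 1"

definition wirtinger :: "(complex \<Rightarrow> complex) \<Rightarrow> complex \<Rightarrow> complex" where
  "wirtinger f z =
     (frechet_derivative f (at z) 1 - \<i> * frechet_derivative f (at z) \<i>) / 2"

definition wirtinger_bar :: "(complex \<Rightarrow> complex) \<Rightarrow> complex \<Rightarrow> complex" where
  "wirtinger_bar f z =
     (frechet_derivative f (at z) 1 + \<i> * frechet_derivative f (at z) \<i>) / 2"

definition canonical_rep ::
  "(complex \<Rightarrow> complex) \<Rightarrow> (complex \<Rightarrow> complex) \<Rightarrow> (complex \<Rightarrow> complex) \<Rightarrow> bool" where
  "canonical_rep f h g \<longleftrightarrow>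
     h holomorphic_on unit_disk \<and> g holomorphic_on unit_disk \<and>
     (\<exists>a. \<forall>z\<in>unit_disk. (\<lambda>n. a (n + 2) * z ^ (n + 2)) sums (h z - z)) \<and>
     (\<exists>b. \<forall>z\<in>unit_disk. (\<lambda>n. b (n + 1) * z ^ (n + 1)) sums g z) \<and>
     (\<forall>z\<in>unit_disk. f z = h z + cnj (g z))"

text \<open>
  The functions are total, but only their values on the unit disk matter.
  Harmonicity of \<open>f\<close> is implied by the representation.
\<close>

definition harmonic_class :: "(complex \<Rightarrow> complex) set" where
  "harmonic_class = {f. \<exists>h g. canonical_rep f h g}"

definition S_H :: "(complex \<Rightarrow> complex) set" where
  "S_H = {f \<in> harmonic_class. inj_on f unit_disk \<and>
     (\<exists>h g. canonical_rep f h g \<and>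
        (\<forall>z\<in>unit_disk. (cmod (deriv h z))\<^sup>2 - (cmod (deriv g z))\<^sup>2 > 0))}"

definition C_H1 :: "(complex \<Rightarrow> complex) set" where
  "C_H1 = {f \<in> S_H. \<forall>z\<in>unit_disk. Re (wirtinger f z) > cmod (wirtinger_bar f z)}"

text \<open>The library's \<^const>\<open>starlike\<close> leaves the centre existentially quantified.\<close>

definition starlike_domain :: "complex set \<Rightarrow> bool" where
  "starlike_domain S \<longleftrightarrow>
     open S \<and> connected S \<and> 0 \<in> S \<and> (\<forall>w\<in>S. closed_segment 0 w \<subseteq> S)"

definition S_H_star0 :: "(complex \<Rightarrow> complex) set" where
  "S_H_star0 = {f \<in> S_H. wirtinger_bar f 0 = 0 \<and> starlike_domain (f ` unit_disk)}"

definition fully_starlike :: "(complex \<Rightarrow> complex) \<Rightarrow> bool" where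
  "fully_starlike f \<longleftrightarrow> (\<forall>r. 0 < r \<and> r < 1 \<longrightarrow> starlike_domain (f ` ball 0 r))"

text \<open>
  The derivatives of the two parts do not depend on the chosen representation:
  they are the Wirtinger derivatives of \<open>f\<close>.
\<close>

lemma canonical_rep_wirtinger:
  assumes "canonical_rep f h g" "z \<in> unit_disk"
  shows "wirtinger f z = deriv h z" and "wirtinger_bar f z = cnj (deriv g z)"
proof -
  have h: "(h has_field_derivative deriv h z) (at z)"
    and g: "(g has_field_derivative deriv g z) (at z)"
    using assms unfolding canonical_rep_def
    by (auto intro: holomorphic_derivI[of _ unit_disk])
  have "((\<lambda>w. h w + cnj (g w)) has_derivative
      (\<lambda>v. deriv h z * v + cnj (deriv g z * v))) (at z)"
    using h g unfolding has_field_derivative_def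
    by (intro has_derivative_add has_derivative_cnj)
  then have "(f has_derivative (\<lambda>v. deriv h z * v + cnj (deriv g z * v))) (at z)"
    by (rule has_derivative_transform_within_open[of _ _ _ _ unit_disk])
      (use assms in \<open>auto simp: canonical_rep_def\<close>)
  then have "frechet_derivative f (at z) = (\<lambda>v. deriv h z * v + cnj (deriv g z * v))"
    by (rule frechet_derivative_at[symmetric])
  then show "wirtinger f z = deriv h z" and "wirtinger_bar f z = cnj (deriv g z)"
    by (simp_all add: wirtinger_def wirtinger_bar_def algebra_simps)
qed

end

theory Submission
  imports Defs
begin

text \<open>
  Write \<open>g z = (\<Sum>j\<in>J. b j * z ^ j)\<close> for the co-analytic part. By the Chu-Vandermonde
  identity the hypothesis says exactly \<open>(\<Sum>j\<in>J. j * \<bar>b j\<bar>) \<le> 1\<close>, so \<open>\<bar>g'\<bar> < 1\<close> in the disk,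
  which gives univalence and membership in \<^const>\<open>C_H1\<close>. For starlikeness,
  \<open>\<bar>t a ^ j - b ^ j\<bar> \<le> j r ^ (j - 1) \<bar>t a - b\<bar>\<close> whenever \<open>\<bar>a\<bar> = \<bar>b\<bar> = r\<close> and \<open>0 \<le> t \<le> 1\<close>;
  hence the half-open segment from 0 to \<open>f a\<close> misses the image of the circle \<open>\<bar>z\<bar> = r\<close>,
  and by connectedness it stays in the image of the open disk of radius \<open>r\<close>.
\<close>

section \<open>Chu-Vandermonde sums\<close>

lemma pochhammer_binomial_fact:
  assumes "n \<le> m"
  shows "pochhammer (real m - real n + 1) n = real (m choose n) * fact n"
  using assms by (simp add: binomial_gbinomial gbinomial_pochhammer')

text \<open>This is the terminating Gauss series 2F1(-m, -m; c; 1): (-m)_n = (-1)^n (m-n+1)_n occurs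
  twice, so the signs cancel, and C(m,n) = (m-n+1)_n / n! supplies the factorial.\<close>

lemma sum_binomial_pochhammer:
  fixes c :: real
  assumes "c > 0"
  shows "(\<Sum>n=0..m. real (m choose n) * (pochhammer (real m - real n + 1) n / pochhammer c n))
    = pochhammer (c + real m) m / pochhammer c m"
proof -
  have "(\<Sum>n=0..m. real (m choose n) * (pochhammer (real m - real n + 1) n / pochhammer c n))
    = (\<Sum>n=0..m. pochhammer (- real m) n * pochhammer (- real m) n / (of_nat (fact n) * pochhammer c n))"
  proof (rule sum.cong[OF refl])
    fix n assume "n \<in> {0..m}"
    then have "real (m choose n) = pochhammer (real m - real n + 1) n / fact n"
      by (simp add: pochhammer_binomial_fact)
    then show "real (m choose n) * (pochhammer (real m - real n + 1) n / pochhammer c n)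
      = pochhammer (- real m) n * pochhammer (- real m) n / (of_nat (fact n) * pochhammer c n)"
      by (simp add: pochhammer_minus power_mult_distrib[symmetric] mult.assoc[symmetric])
  qed
  also have "\<dots> = pochhammer (c - (- real m)) m / pochhammer c m"
    using assms by (intro Vandermonde_pochhammer) auto
  finally show ?thesis by simp
qed

text \<open>The summand is n C(m,n)^2 n! / (c)_n. The weight n and a factor n taken from n! allow
  absorption, n C(m,n) = m C(m-1,n-1), in both binomials; what remains is the previous sum with m-1
  and c+1.\<close>

lemma sum_index_binomial_pochhammer:
  fixes c :: real
  assumes "c > 0" "m \<ge> 1"
  shows "(\<Sum>n=0..m. real n * (real (m choose n) * (pochhammer (real m - real n + 1) n / pochhammer c n)))
    = (real m)\<^sup>2 * pochhammer (c + real m) (m - 1) / pochhammer c m"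
proof -
  obtain k where m: "m = Suc k"
    using assms by (cases m) auto
  have "(\<Sum>n=0..m. real n * (real (m choose n) * (pochhammer (real m - real n + 1) n / pochhammer c n)))
    = (\<Sum>n=0..k. real (Suc n) * (real (m choose Suc n)
        * (pochhammer (real m - real (Suc n) + 1) (Suc n) / pochhammer c (Suc n))))"
    unfolding m by (subst sum.atLeast0_atMost_Suc_shift) (simp del: binomial_Suc_Suc of_nat_Suc)
  also have "\<dots> = (\<Sum>n=0..k. (real m)\<^sup>2 / c *
      (real (k choose n) * (pochhammer (real k - real n + 1) n / pochhammer (c + 1) n)))"
  proof (rule sum.cong[OF refl])
    fix n assume n: "n \<in> {0..k}"
    have absorb: "real (Suc n) * real (m choose Suc n) = real m * real (k choose n)"
      using Suc_times_binomial_eq[of k n] m by (metis of_nat_mult mult.commute)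
    have "real (Suc n) * (real (m choose Suc n)
        * (pochhammer (real m - real (Suc n) + 1) (Suc n) / pochhammer c (Suc n)))
      = (real (Suc n) * real (m choose Suc n)) * (real (m choose Suc n) * fact (Suc n)) / pochhammer c (Suc n)"
      using n m by (subst pochhammer_binomial_fact) auto
    also have "\<dots> = (real (Suc n) * real (m choose Suc n)) * (real (Suc n) * real (m choose Suc n))
        * fact n / (c * pochhammer (c + 1) n)"
      by (simp add: pochhammer_rec)
    also have "\<dots> = (real m)\<^sup>2 / c * (real (k choose n) * (real (k choose n) * fact n / pochhammer (c + 1) n))"
      unfolding absorb by (simp add: power2_eq_square)
    finally show "real (Suc n) * (real (m choose Suc n)
        * (pochhammer (real m - real (Suc n) + 1) (Suc n) / pochhammer c (Suc n)))
      = (real m)\<^sup>2 / c * (real (k choose n) * (pochhammer (real k - real n + 1) n / pochhammer (c + 1) n))"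
      using n by (simp add: pochhammer_binomial_fact)
  qed
  also have "\<dots> = (real m)\<^sup>2 / c * (pochhammer (c + 1 + real k) k / pochhammer (c + 1) k)"
    using assms by (subst sum_distrib_left[symmetric], subst sum_binomial_pochhammer) auto
  also have "\<dots> = (real m)\<^sup>2 * pochhammer (c + real m) (m - 1) / pochhammer c m"
    by (simp add: m pochhammer_rec add_ac)
  finally show ?thesis .
qed

text \<open>The weight \<open>n + k\<close> is the exponent of the n-th term after multiplication by
  \<open>z ^ k\<close>; k = 1, 2 produce the two brackets of the theorem.\<close>

lemma sum_shifted_index_Gamma:
  fixes c :: real
  assumes "c > 0" "m \<ge> 1"
  shows "(\<Sum>n=0..m. real (n + k) * (real (m choose n) * (pochhammer (real m - real n + 1) n / pochhammer c n)))
    = Gamma c * Gamma (c + 2 * real m - 1) / (Gamma (c + real m))\<^sup>2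
        * ((real m)\<^sup>2 + real k * (c + 2 * real m - 1))"
proof -
  have nonpos: "c \<notin> \<int>\<^sub>\<le>\<^sub>0" "c + real m \<notin> \<int>\<^sub>\<le>\<^sub>0"
    using assms by (auto simp: nonpos_Ints_def)
  have G: "pochhammer (c + real m) (m - 1) / pochhammer c m
    = Gamma c * Gamma (c + 2 * real m - 1) / (Gamma (c + real m))\<^sup>2"
    using assms nonpos by (simp add: pochhammer_Gamma of_nat_diff power2_eq_square add_ac)
      (simp add: algebra_simps)
  \<comment> \<open>Splitting off the last factor of (c+m)_m leaves the quotient in \<open>G\<close>
    common to both sums.\<close>
  have last_factor: "pochhammer (c + real m) m = pochhammer (c + real m) (m - 1) * (c + 2 * real m - 1)"
    using assms pochhammer_Suc[of "c + real m" "m - 1"] by (simp add: of_nat_diff algebra_simps)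
  have "(\<Sum>n=0..m. real (n + k) * (real (m choose n) * (pochhammer (real m - real n + 1) n / pochhammer c n)))
    = (real m)\<^sup>2 * pochhammer (c + real m) (m - 1) / pochhammer c m
      + real k * (pochhammer (c + real m) m / pochhammer c m)"
    unfolding of_nat_add distrib_right sum.distrib sum_distrib_left[symmetric]
    using assms by (simp only: sum_binomial_pochhammer sum_index_binomial_pochhammer)
  then show ?thesis
    unfolding last_factor G[symmetric] by (simp add: distrib_left mult_ac)
qed

section \<open>Power differences\<close>

lemma cmod_power_diff_le:
  fixes z w :: complex
  assumes "cmod z \<le> r" "cmod w \<le> r"
  shows "cmod (z ^ j - w ^ j) \<le> real j * r ^ (j - 1) * cmod (z - w)"
proof (cases "r = 0")
  case True
  then show ?thesis using assms by simp
next
  case False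
  then have r: "r > 0"
    using assms norm_ge_zero[of z] by linarith
  have "cmod ((z / r) ^ j - (w / r) ^ j) \<le> real j * cmod (z / r - w / r)"
    using assms r by (intro norm_power_diff) (auto simp: norm_divide)
  then have "cmod (z ^ j - w ^ j) / r ^ j \<le> real j * (cmod (z - w) / r)"
    using r by (simp add: power_divide diff_divide_distrib[symmetric] norm_divide norm_power)
  then show ?thesis
    using r by (cases j) (auto simp: field_simps)
qed

text \<open>For equal moduli the law of cosines separates a radial part from a chordal part, and
  each can be compared with its counterpart for j-th powers.\<close>

lemma cmod_scaled_diff_power2:
  fixes a b :: complex
  assumes "cmod a = r" "cmod b = r"
  shows "(cmod (of_real t * a - b))\<^sup>2 = (1 - t)\<^sup>2 * r\<^sup>2 + t * (cmod (a - b))\<^sup>2"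
proof -
  have "(Re a)\<^sup>2 + (Im a)\<^sup>2 = r\<^sup>2" "(Re b)\<^sup>2 + (Im b)\<^sup>2 = r\<^sup>2"
    using assms cmod_power2 by metis+
  then show ?thesis
    unfolding cmod_power2 by (simp add: power2_eq_square) algebra
qed

text \<open>The factor t stays outside the power because the estimate is applied to t g(a) - g(b).
  The preceding identity is used for a, b and for their j-th powers: the radial parts compare by 1
  \<le> j^2, the chordal parts by \<open>cmod_power_diff_le\<close>.\<close>

lemma cmod_scaled_power_diff_le:
  fixes a b :: complex
  assumes "cmod a = r" "cmod b = r" "0 \<le> t" "j \<ge> 1"
  shows "cmod (of_real t * a ^ j - b ^ j) \<le> real j * r ^ (j - 1) * cmod (of_real t * a - b)"
proof (rule power2_le_imp_le)
  have r: "r \<ge> 0" using assms by auto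
  have "r ^ j = r ^ (j - 1) * r"
    using assms by (cases j) auto
  then have "(1 - t)\<^sup>2 * (r ^ j)\<^sup>2 \<le> (real j * r ^ (j - 1))\<^sup>2 * ((1 - t)\<^sup>2 * r\<^sup>2)"
    using assms mult_right_mono[of 1 "(real j)\<^sup>2" "(1 - t)\<^sup>2 * (r ^ j)\<^sup>2"]
    by (simp add: power_mult_distrib mult_ac)
  moreover have "(cmod (a ^ j - b ^ j))\<^sup>2 \<le> (real j * r ^ (j - 1) * cmod (a - b))\<^sup>2"
    using assms by (intro power_mono cmod_power_diff_le) auto
  then have "t * (cmod (a ^ j - b ^ j))\<^sup>2 \<le> (real j * r ^ (j - 1))\<^sup>2 * (t * (cmod (a - b))\<^sup>2)"
    using assms mult_left_mono[of _ _ t] by (fastforce simp: power_mult_distrib mult_ac)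
  ultimately show "(cmod (of_real t * a ^ j - b ^ j))\<^sup>2
      \<le> (real j * r ^ (j - 1) * cmod (of_real t * a - b))\<^sup>2"
    using assms
    by (simp add: cmod_scaled_diff_power2[of "a ^ j" "r ^ j"] cmod_scaled_diff_power2[of a r]
        norm_power power_mult_distrib distrib_left)
  show "0 \<le> real j * r ^ (j - 1) * cmod (of_real t * a - b)"
    using r by simp
qed

section \<open>Harmonic maps with small polynomial co-analytic part\<close>

lemma canonical_rep_id:
  assumes "g holomorphic_on unit_disk" "g 0 = 0"
  shows "canonical_rep (\<lambda>z. z + cnj (g z)) (\<lambda>z. z) g"
proof -
  define b where "b n = (deriv ^^ n) g 0 / fact n" for n
  have "(\<lambda>n. b (n + 1) * z ^ (n + 1)) sums g z" if "z \<in> unit_disk" for z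
  proof -
    have "(\<lambda>n. b n * z ^ n) sums g z"
      using holomorphic_power_series[OF assms(1) that] by (simp add: b_def)
    moreover have "b 0 = 0"
      using assms by (simp add: b_def)
    ultimately show ?thesis
      \<comment> \<open>As \<open>b 0 = 0\<close>, the Taylor series may start at exponent
        1.\<close>
      using sums_Suc_iff[of "\<lambda>n. b n * z ^ n" "g z"] by simp
  qed
  then have "\<exists>b. \<forall>z\<in>unit_disk. (\<lambda>n. b (n + 1) * z ^ (n + 1)) sums g z"
    by blast
  moreover have "\<exists>a. \<forall>z\<in>unit_disk. (\<lambda>n. a (n + 2) * z ^ (n + 2)) sums (z - z :: complex)"
    by (rule exI[of _ "\<lambda>_. 0"]) simp
  ultimately show ?thesis
    using assms by (auto simp: canonical_rep_def)
qed

text \<open>\<open>sum_le_1\<close> alone gives only |g'| \<le> 1 in the disk;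
  \<open>nonlinear\<close> makes this strict. It excludes g(z) = z, where f(z) = 2 Re z is not
  injective.\<close>

locale small_polynomial =
  fixes J :: "nat set" and b :: "nat \<Rightarrow> complex" and g f :: "complex \<Rightarrow> complex"
  assumes finite_J: "finite J"
    and J_ge_1: "\<And>j. j \<in> J \<Longrightarrow> j \<ge> 1"
    and sum_le_1: "(\<Sum>j\<in>J. real j * cmod (b j)) \<le> 1"
    and nonlinear: "\<exists>j\<in>J. j \<ge> 2 \<and> b j \<noteq> 0"
    and g_eq: "\<And>z. g z = (\<Sum>j\<in>J. b j * z ^ j)"
    and f_eq: "\<And>z. f z = z + cnj (g z)"
begin

lemma g_0: "g 0 = 0"
  using J_ge_1 by (fastforce simp: g_eq intro: sum.neutral)

lemma f_0: "f 0 = 0"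
  by (simp add: f_eq g_0)

lemma g_deriv: "(g has_field_derivative (\<Sum>j\<in>J. b j * (of_nat j * z ^ (j - 1)))) (at z)"
  unfolding g_eq[abs_def] by (auto intro!: derivative_eq_intros sum.cong)

lemma g_holomorphic: "g holomorphic_on S"
  unfolding g_eq[abs_def] by (intro holomorphic_intros)

lemma continuous_f: "continuous_on S f"
  unfolding f_eq[abs_def] g_eq[abs_def] by (intro continuous_intros)

text \<open>Every term is at most \<open>real j * cmod (b j)\<close>, and the term supplied by
  \<open>nonlinear\<close> is strictly smaller because its power of r has positive exponent.\<close>

lemma weighted_sum_less_1:
  assumes "0 \<le> r" "r < 1"
  shows "(\<Sum>j\<in>J. cmod (b j) * (real j * r ^ (j - 1))) < 1"
proof -
  obtain i where i: "i \<in> J" "i \<ge> 2" "b i \<noteq> 0"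
    using nonlinear by blast
  have "r ^ (i - 1) < 1"
    using assms i by (intro power_less_one_iff[THEN iffD2]) auto
  then have "cmod (b i) * (real i * r ^ (i - 1)) < real i * cmod (b i)"
    using i by (simp add: mult.commute)
  moreover have "cmod (b j) * (real j * r ^ (j - 1)) \<le> real j * cmod (b j)" for j
    using assms by (simp add: mult_left_le power_le_one mult.assoc[symmetric] mult.commute[of "cmod _"])
  ultimately have "(\<Sum>j\<in>J. cmod (b j) * (real j * r ^ (j - 1))) < (\<Sum>j\<in>J. real j * cmod (b j))"
    using i finite_J by (intro sum_strict_mono_ex1 bexI[of _ i]) auto
  then show ?thesis
    using sum_le_1 by simp
qed

lemma cmod_deriv_g_less_1:
  assumes "cmod z < 1"
  shows "cmod (deriv g z) < 1"
proof -
  have "cmod (deriv g z) \<le> (\<Sum>j\<in>J. cmod (b j) * (real j * cmod z ^ (j - 1)))"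
    using g_deriv[of z]
    by (auto simp: DERIV_imp_deriv norm_mult norm_power intro: sum_norm_le)
  also have "\<dots> < 1"
    using assms by (intro weighted_sum_less_1) auto
  finally show ?thesis .
qed

text \<open>Common core of univalence (t = 1) and starlikeness (t < 1). Equality would force |tx -
  y| = |t g(x) - g(y)|, whereas the termwise bounds make the right side strictly smaller.\<close>

lemma g_contracts:
  assumes "0 \<le> r" "r < 1" "of_real t * x \<noteq> y"
    and "\<And>j. j \<in> J \<Longrightarrow> cmod (of_real t * x ^ j - y ^ j) \<le> real j * r ^ (j - 1) * cmod (of_real t * x - y)"
  shows "f y \<noteq> of_real t * f x"
proof
  assume "f y = of_real t * f x"
  then have "of_real t * x - y = cnj (- (of_real t * g x - g y))"
    by (simp add: f_eq algebra_simps)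
  then have "cmod (of_real t * x - y) = cmod (of_real t * g x - g y)"
    by (metis complex_mod_cnj norm_minus_cancel)
  also have "of_real t * g x - g y = (\<Sum>j\<in>J. b j * (of_real t * x ^ j - y ^ j))"
    by (simp add: g_eq sum_distrib_left right_diff_distrib sum_subtractf mult_ac)
  also have "cmod \<dots> \<le> (\<Sum>j\<in>J. cmod (b j) * (real j * r ^ (j - 1) * cmod (of_real t * x - y)))"
    using assms(4) by (intro sum_norm_le) (auto simp: norm_mult intro: mult_left_mono)
  also have "\<dots> = (\<Sum>j\<in>J. cmod (b j) * (real j * r ^ (j - 1))) * cmod (of_real t * x - y)"
    by (simp add: sum_distrib_right mult.assoc)
  also have "\<dots> < cmod (of_real t * x - y)"
    using assms weighted_sum_less_1[of r] by simp
  finally show False by simp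
qed

section \<open>Univalence and starlike images of disks\<close>

lemma inj_f: "inj_on f unit_disk"
proof (rule inj_onI, rule ccontr)
  fix x y assume xy: "x \<in> unit_disk" "y \<in> unit_disk" "f x = f y" "x \<noteq> y"
  define r where "r = max (cmod x) (cmod y)"
  have "f y \<noteq> of_real 1 * f x"
    using xy cmod_power_diff_le[of x r y]
    by (intro g_contracts[of r]) (auto simp: r_def le_max_iff_disj)
  then show False using xy by simp
qed

lemma ray_avoids_circle_image:
  assumes "cmod x = r" "cmod y = r" "0 < r" "r < 1" "0 \<le> t" "t < 1"
  shows "f y \<noteq> of_real t * f x"
proof (rule g_contracts[of r])
  have "cmod (of_real t * x) < cmod y"
    using assms by (simp add: norm_mult)
  then show "of_real t * x \<noteq> y" by auto
qed (use assms J_ge_1 cmod_scaled_power_diff_le in auto)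

lemma open_image:
  assumes "r \<le> 1"
  shows "open (f ` ball 0 r)"
  using assms inj_f
  by (intro invariance_of_domain continuous_f) (auto intro: inj_on_subset)

lemma half_open_segment_subset:
  assumes "0 < cmod x" "cmod x < 1"
  shows "(\<lambda>t. of_real t * f x) ` {0..<1} \<subseteq> f ` ball 0 (cmod x)"
proof -
  let ?L = "(\<lambda>t. of_real t * f x) ` {0..<1::real}"
  let ?V = "f ` ball 0 (cmod x)" and ?K = "f ` cball 0 (cmod x)"
  have "connected ?L"
    by (intro connected_continuous_image continuous_intros) auto
  moreover have "open ?V"
    using assms by (intro open_image) auto
  moreover have "open (- ?K)"
    by (intro open_Compl compact_imp_closed compact_continuous_image continuous_f) auto
  moreover have "?V \<inter> - ?K \<inter> ?L = {}"
    by auto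
  \<comment> \<open>A point of \<open>?L\<close> in \<open>?K\<close> but outside \<open>?V\<close>
    would be the image of a point on the circle of radius |x|, which
    \<open>ray_avoids_circle_image\<close> forbids.\<close>
  moreover have "?L \<subseteq> ?V \<union> - ?K"
    using assms ray_avoids_circle_image[OF refl, of _ x]
    by (fastforce simp: less_le)
  ultimately have "?V \<inter> ?L = {} \<or> - ?K \<inter> ?L = {}"
    by (rule connectedD)
  moreover have "0 \<in> ?V" "0 \<in> ?L"
    using assms f_0 by (force intro: image_eqI[of _ _ 0])+
  \<comment> \<open>The point 0 lies in \<open>?V\<close> and \<open>?L\<close>, so connectedness
    leaves only the alternative that \<open>?L\<close> misses the complement of
    \<open>?K\<close>.\<close>
  ultimately show ?thesis
    using \<open>?L \<subseteq> ?V \<union> - ?K\<close> by blast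
qed

lemma starlike_image:
  assumes "0 < r" "r \<le> 1"
  shows "starlike_domain (f ` ball 0 r)"
  unfolding starlike_domain_def
proof (intro conjI ballI subsetI)
  show "open (f ` ball 0 r)"
    using assms by (rule_tac open_image)
  show "connected (f ` ball 0 r)"
    by (intro connected_continuous_image continuous_f) auto
  show zero: "0 \<in> f ` ball 0 r"
    using assms f_0 by (intro image_eqI[of _ _ 0]) auto
  fix w v assume w: "w \<in> f ` ball 0 r" and v: "v \<in> closed_segment 0 w"
  obtain x where x: "w = f x" "cmod x < r"
    using w by auto
  obtain t where t: "v = of_real t * w" "0 \<le> t" "t \<le> 1"
    using v by (auto simp: in_segment scaleR_conv_of_real)
  \<comment> \<open>The segment lemma needs a circle of positive radius and omits the endpoint; both
    exceptions are immediate, since |x| < r already puts f(x) in the image.\<close>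
  consider "t = 1" | "x = 0" | "t < 1" "x \<noteq> 0"
    using t by fastforce
  then show "v \<in> f ` ball 0 r"
  proof cases
    case 1
    then show ?thesis using t w by simp
  next
    case 2
    then show ?thesis using t x f_0 zero by simp
  next
    case 3
    then have "v \<in> f ` ball 0 (cmod x)"
      using half_open_segment_subset[of x] x t assms by force
    then show ?thesis using x by auto
  qed
qed

section \<open>Membership in the function classes\<close>

lemma canonical_rep_f: "canonical_rep f (\<lambda>z. z) g"
  unfolding f_eq[abs_def] by (intro canonical_rep_id g_holomorphic g_0)

lemma f_in_C_H1: "f \<in> C_H1"
proof -
  have less: "cmod (deriv g z) < 1" if "z \<in> unit_disk" for z
    using that cmod_deriv_g_less_1 by simp
  then have "(cmod (deriv (\<lambda>z. z) z))\<^sup>2 - (cmod (deriv g z))\<^sup>2 > 0" if "z \<in> unit_disk" for z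
    using that by (simp add: power_less_one_iff)
  then have "f \<in> S_H"
    using canonical_rep_f inj_f unfolding S_H_def harmonic_class_def by blast
  then show ?thesis
    using less by (simp add: C_H1_def canonical_rep_wirtinger[OF canonical_rep_f])
qed

lemma f_in_S_H_star0:
  assumes "1 \<notin> J"
  shows "f \<in> S_H_star0"
proof -
  have "deriv g 0 = (\<Sum>j\<in>J. b j * (of_nat j * 0 ^ (j - 1)))"
    by (intro DERIV_imp_deriv g_deriv)
  also have "\<dots> = 0"
  proof (intro sum.neutral ballI)
    fix j assume "j \<in> J"
    \<comment> \<open>A linear term would survive at the origin, since
      \<open>0 ^ 0 = 1\<close>.\<close>
    then have "j - 1 > 0"
      using assms J_ge_1[of j] by (cases "j = 1") auto
    then show "b j * (of_nat j * 0 ^ (j - 1)) = 0" by simp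
  qed
  finally have "wirtinger_bar f 0 = 0"
    by (simp add: canonical_rep_wirtinger[OF canonical_rep_f])
  then show ?thesis
    using f_in_C_H1 starlike_image[of 1] by (simp add: S_H_star0_def C_H1_def)
qed

lemma fully_starlike_f: "fully_starlike f"
  using starlike_image by (simp add: fully_starlike_def)

end

section \<open>Application to the hypergeometric polynomials\<close>

lemma small_polynomial_hypergeometric:
  fixes c :: real and \<alpha> :: complex and f :: "complex \<Rightarrow> complex"
  defines "A \<equiv> \<lambda>m n. real (m choose n) * (pochhammer (real m - real n + 1) n / pochhammer c n)"
  assumes "m \<ge> 1" "c > 0" "k \<ge> 1" "\<alpha> \<noteq> 0"
    and f: "\<And>z. f z = z + cnj (\<alpha> * z ^ k * (\<Sum>n=0..m. of_real (A m n) * z ^ n))"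
    and bound: "Gamma c * Gamma (c + 2 * real m - 1) / (Gamma (c + real m))\<^sup>2
        * ((real m)\<^sup>2 + real k * (c + 2 * real m - 1)) \<le> 1 / cmod \<alpha>"
  shows "small_polynomial {k..m + k} (\<lambda>j. \<alpha> * of_real (A m (j - k)))
    (\<lambda>z. \<Sum>j=k..m + k. \<alpha> * of_real (A m (j - k)) * z ^ j) f"
proof unfold_locales
  have shift: "sum u {k..m + k} = (\<Sum>n=0..m. u (n + k))" for u :: "nat \<Rightarrow> 'b::comm_monoid_add"
    using sum.shift_bounds_cl_nat_ivl[of u 0 k m] by simp
  \<comment> \<open>Positivity gives the coefficients modulus |\<alpha>| \<open>A m n\<close>, so
    their weighted sum is the closed form exactly, and it also makes the top coefficient
    nonzero.\<close>
  have pos: "A m n > 0" if "n \<le> m" for n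
    using that assms(3) by (auto simp: A_def pochhammer_binomial_fact intro!: mult_pos_pos divide_pos_pos pochhammer_pos)
  show "(\<Sum>j=k..m + k. real j * cmod (\<alpha> * of_real (A m (j - k)))) \<le> 1"
  proof -
    have "(\<Sum>j=k..m + k. real j * cmod (\<alpha> * of_real (A m (j - k))))
        = cmod \<alpha> * (\<Sum>n=0..m. real (n + k) * A m n)"
      unfolding shift sum_distrib_left
      by (intro sum.cong) (auto simp: norm_mult abs_of_pos[OF pos] simp del: of_nat_add)
    also have "\<dots> \<le> cmod \<alpha> * (1 / cmod \<alpha>)"
      using bound assms sum_shifted_index_Gamma[of c m k] by (intro mult_left_mono) (auto simp: A_def)
    finally show ?thesis using assms by simp
  qed
  show "\<exists>j\<in>{k..m + k}. j \<ge> 2 \<and> \<alpha> * of_real (A m (j - k)) \<noteq> 0"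
    \<comment> \<open>The leading exponent \<open>m + k\<close> is at least 2 because m and k are
      both positive.\<close>
    using assms(2,4,5) pos[of m] by (intro bexI[of _ "m + k"]) auto
  show "f z = z + cnj (\<Sum>j=k..m + k. \<alpha> * of_real (A m (j - k)) * z ^ j)" for z
    unfolding f shift by (simp add: sum_distrib_left power_add mult_ac)
qed (use assms(4) in auto)

theorem corollary2:
  fixes m :: nat and c :: real and \<alpha> :: complex
    and f :: "nat \<Rightarrow> complex \<Rightarrow> complex"
  assumes "m \<ge> 1" and "c > 0"
    and "\<And>k z. k \<in> {1, 2} \<Longrightarrow>
      f k z = z + cnj (\<alpha> * z ^ k * (\<Sum>n=0..m.
        of_real (real (m choose n) * (pochhammer (real m - real n + 1) n / pochhammer c n)) * z ^ n))"
  shows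
    "(0 < cmod \<alpha> \<and> cmod \<alpha> < 1 / 2 \<and>
      Gamma c * Gamma (c + 2 * real m - 1) / (Gamma (c + real m))\<^sup>2
        * ((real m)\<^sup>2 + 2 * (c + 2 * real m - 1)) \<le> 1 / cmod \<alpha>
      \<longrightarrow> f 2 \<in> S_H_star0 \<inter> C_H1 \<and> fully_starlike (f 2))
   \<and> (0 < cmod \<alpha> \<and> cmod \<alpha> < 1 \<and>
      Gamma c * Gamma (c + 2 * real m - 1) / (Gamma (c + real m))\<^sup>2
        * ((real m)\<^sup>2 + c + 2 * real m - 1) \<le> 1 / cmod \<alpha>
      \<longrightarrow> f 1 \<in> C_H1)"
proof (intro conjI impI; elim conjE)
  assume "0 < cmod \<alpha>"
    and "Gamma c * Gamma (c + 2 * real m - 1) / (Gamma (c + real m))\<^sup>2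
      * ((real m)\<^sup>2 + 2 * (c + 2 * real m - 1)) \<le> 1 / cmod \<alpha>"
  then interpret small_polynomial "{2..m + 2}"
    "\<lambda>j. \<alpha> * of_real (real (m choose (j - 2)) * (pochhammer (real m - real (j - 2) + 1) (j - 2) / pochhammer c (j - 2)))"
    "\<lambda>z. \<Sum>j=2..m + 2. \<alpha> * of_real (real (m choose (j - 2)) * (pochhammer (real m - real (j - 2) + 1) (j - 2) / pochhammer c (j - 2))) * z ^ j"
    "f 2"
    using assms by (intro small_polynomial_hypergeometric) auto
  \<comment> \<open>Here the exponents start at 2, which is the condition
    \<open>1 \<notin> J\<close> of \<open>f_in_S_H_star0\<close>.\<close>
  show "f 2 \<in> S_H_star0 \<inter> C_H1" "fully_starlike (f 2)"
    using f_in_S_H_star0 f_in_C_H1 fully_starlike_f by auto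
next
  assume "0 < cmod \<alpha>"
    and "Gamma c * Gamma (c + 2 * real m - 1) / (Gamma (c + real m))\<^sup>2
      * ((real m)\<^sup>2 + c + 2 * real m - 1) \<le> 1 / cmod \<alpha>"
  then interpret small_polynomial "{1..m + 1}"
    "\<lambda>j. \<alpha> * of_real (real (m choose (j - 1)) * (pochhammer (real m - real (j - 1) + 1) (j - 1) / pochhammer c (j - 1)))"
    "\<lambda>z. \<Sum>j=1..m + 1. \<alpha> * of_real (real (m choose (j - 1)) * (pochhammer (real m - real (j - 1) + 1) (j - 1) / pochhammer c (j - 1))) * z ^ j"
    "f 1"
    using assms by (intro small_polynomial_hypergeometric) (auto simp: algebra_simps)
  show "f 1 \<in> C_H1"
    by (rule f_in_C_H1)
qed

end
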